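(* Let $\mathscr{A}$ be a unital $C^*$-algebra, equipped with its standard right Hilbert $\mathscr{A}$-module structure given by $\langle x,y\rangle=x^*y$ for $x,y\in\mathscr{A}$. Let $T:\mathscr{A}\to\mathscr{A}$ be a bounded conjugate-linear operator that is adjointable in the sense that there is a bounded conjugate-linear operator $T^*:\mathscr{A}\to\mathscr{A}$ with $\langle Tx,y\rangle=\langle x,T^*y\rangle^*$ for all $x,y\in\mathscr{A}$. Then the range of $T$ satisfies $\mathcal{R}(T)\subseteq\mathcal{Z}(\mathscr{A})$, and $T$ has the form $$T(x)=x^*a\qquad(x\in\mathscr{A}),$$ where $a\in\mathcal{Z}(\mathscr{A})\cap\mathrm{Ann}(\mathcal{I})$ and $\mathcal{I}=\overline{\operatorname{span}}\{u[x,y]v:u,v,x,y\in\mathscr{A}\}$ is a closed two-sided ideal of $\mathscr{A}$. Moreover, $T^*=T$. In particular, if $\mathscr{A}$ is a noncommutative $C^*$-algebra with $\mathcal{Z}(\mathscr{A})=\mathbb{C}$, then $T=0$.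
   Context: $\mathcal{Z}(\mathscr{A})$ is the center of $\mathscr{A}$, $[x,y]=xy-yx$, and $\mathrm{Ann}(\mathcal{I})=\{z\in\mathscr{A}:z\mathcal{I}=\mathcal{I}z=0\}$. $\mathcal{Z}(\mathscr{A})=\mathbb{C}$ means the center consists of the scalar multiples of the unit. *)

theory Defs
  imports "HOL-Analysis.Analysis"
begin

text \<open>
  The library has no complex normed spaces, so the complex scalar multiplication is added on top
  of the real one (and required to extend it). Completeness and submultiplicativity of the norm
  come from the superclasses.
\<close>

class cstar_algebra = real_normed_algebra + banach +
  fixes scaleC :: "complex \<Rightarrow> 'a \<Rightarrow> 'a"  (infixr "*\<^sub>C" 75)
    and star :: "'a \<Rightarrow> 'a"
  assumes scaleC_of_real: "complex_of_real r *\<^sub>C x = r *\<^sub>R x"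
    and scaleC_add_right: "c *\<^sub>C (x + y) = c *\<^sub>C x + c *\<^sub>C y"
    and scaleC_add_left: "(c + d) *\<^sub>C x = c *\<^sub>C x + d *\<^sub>C x"
    and scaleC_scaleC: "c *\<^sub>C d *\<^sub>C x = (c * d) *\<^sub>C x"
    and norm_scaleC: "norm (c *\<^sub>C x) = cmod c * norm x"
    and mult_scaleC_left: "(c *\<^sub>C x) * y = c *\<^sub>C (x * y)"
    and mult_scaleC_right: "x * (c *\<^sub>C y) = c *\<^sub>C (x * y)"
    and star_star: "star (star x) = x"
    and star_add: "star (x + y) = star x + star y"
    and star_scaleC: "star (c *\<^sub>C x) = cnj c *\<^sub>C star x"
    and star_mult: "star (x * y) = star y * star x"
    and cstar_identity: "norm (star x * x) = (norm x)\<^sup>2"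

text \<open>
  The unit comes from \<open>monoid_mult\<close> rather than \<open>real_normed_algebra_1\<close>, whose axioms
  \<open>0 \<noteq> 1\<close> and \<open>norm 1 = 1\<close> would exclude the zero algebra; in a nonzero
  algebra both follow from the C*-identity.
\<close>

class unital_cstar_algebra = cstar_algebra + monoid_mult

lemma vector_space_scaleC: "vector_space (scaleC :: complex \<Rightarrow> 'a::cstar_algebra \<Rightarrow> 'a)"
proof
  show "1 *\<^sub>C x = x" for x :: 'a
    using scaleC_of_real[of 1 x] by simp
qed (simp_all add: scaleC_add_right scaleC_add_left scaleC_scaleC)

global_interpretation complex_vector:
  vector_space "scaleC :: complex \<Rightarrow> 'a::cstar_algebra \<Rightarrow> 'a"
  defines csubspace = complex_vector.subspace
    and cspan = complex_vector.span
  by (rule vector_space_scaleC)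

definition center :: "'a::times set" where
  "center = {z. \<forall>x. z * x = x * z}"

definition commutator :: "'a::ring \<Rightarrow> 'a \<Rightarrow> 'a" where
  "commutator x y = x * y - y * x"

definition annihilator :: "'a::ring set \<Rightarrow> 'a set" where
  "annihilator I = {z. \<forall>w\<in>I. z * w = 0 \<and> w * z = 0}"

definition closed_two_sided_ideal :: "'a::cstar_algebra set \<Rightarrow> bool" where
  "closed_two_sided_ideal I \<longleftrightarrow>
     csubspace I \<and> closed I \<and> (\<forall>a. \<forall>w\<in>I. a * w \<in> I \<and> w * a \<in> I)"

definition commutator_ideal :: "'a::cstar_algebra set" where
  "commutator_ideal = closure (cspan {u * commutator x y * v |u v x y. True})"

text \<open>The inner product of the algebra as a right Hilbert module over itself.\<close>

definition module_inner :: "'a::cstar_algebra \<Rightarrow> 'a \<Rightarrow> 'a" where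
  "module_inner x y = star x * y"

definition bounded_conj_linear :: "('a::cstar_algebra \<Rightarrow> 'b::cstar_algebra) \<Rightarrow> bool" where
  "bounded_conj_linear T \<longleftrightarrow>
     (\<forall>x y. T (x + y) = T x + T y) \<and>
     (\<forall>c x. T (c *\<^sub>C x) = cnj c *\<^sub>C T x) \<and>
     (\<exists>K. \<forall>x. norm (T x) \<le> K * norm x)"

text \<open>
  The outer \<open>star\<close> is what makes the two sides linear of the same kind in each variable when
  both operators are conjugate-linear.
\<close>

definition is_conj_adjoint :: "('a::cstar_algebra \<Rightarrow> 'a) \<Rightarrow> ('a \<Rightarrow> 'a) \<Rightarrow> bool" where
  "is_conj_adjoint T S \<longleftrightarrow>
     bounded_conj_linear S \<and>
     (\<forall>x y. module_inner (T x) y = star (module_inner x (S y)))"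

end

theory Submission
  imports Defs
begin

text \<open>
  Testing adjointness against the unit gives \<open>T x = star x * a\<close> with \<open>a = T 1\<close>, and also
  \<open>Tadj = T\<close>. Adjointness then says that \<open>star a\<close> kills every commutator from the left, and
  by the Leibniz rule every \<open>u * [x, y]\<close> as well. For \<open>z = [a, x]\<close> this gives
  \<open>star z * z = 0\<close>, so \<open>a\<close> is central by the C*-identity.
\<close>

lemma star_diff: "star (x - y) = star x - star (y :: 'a::cstar_algebra)"
  by (metis star_add add_diff_cancel_right' diff_add_cancel)

lemma star_zero [simp]: "star (0 :: 'a::cstar_algebra) = 0"
  using star_diff[of 0 0] by simp

lemma star_mult_self_eq_0_iff: "star x * x = 0 \<longleftrightarrow> x = (0 :: 'a::cstar_algebra)"
  using cstar_identity[of x] by auto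

text \<open>Since \<open>star\<close> reverses products and is its own inverse,
  \<open>star 1\<close> is again a unit, and units are unique.\<close>

lemma star_one [simp]: "star (1 :: 'a::unital_cstar_algebra) = 1"
  by (metis mult_1_left mult_1_right star_mult star_star)

lemma star_commutator:
  "star (commutator x y) = commutator (star y) (star (x :: 'a::cstar_algebra))"
  by (simp add: commutator_def star_diff star_mult)

text \<open>The map \<open>[-, y]\<close> is a derivation. Solving its product rule for
  \<open>u * [x, y]\<close> leaves only commutators whose extra factor stands on the right, out of
  reach of a multiplication from the left.\<close>

lemma commutator_leibniz: "u * commutator x y = commutator (u * x) y - commutator u y * x"
  by (simp add: commutator_def algebra_simps)

text \<open>Real scalars act as complex ones and complex scalars commute. Real linearity is what
  gives access to \<open>bounded_linear\<close>, hence to continuity.\<close>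

lemma linear_scaleC: "linear (scaleC c :: 'a::cstar_algebra \<Rightarrow> 'a)"
proof (rule linearI)
  show "c *\<^sub>C (r *\<^sub>R x) = r *\<^sub>R (c *\<^sub>C x)" for r and x :: 'a
    by (metis scaleC_of_real scaleC_scaleC mult.commute)
qed (rule scaleC_add_right)

lemma continuous_on_scaleC: "continuous_on A (scaleC c :: 'a::cstar_algebra \<Rightarrow> 'a)"
proof -
  have "bounded_linear (scaleC c :: 'a \<Rightarrow> 'a)"
    by (rule bounded_linear_intro[where K = "cmod c"])
      (simp_all add: linear_add[OF linear_scaleC] linear_cmul[OF linear_scaleC] norm_scaleC
        mult.commute)
  then show ?thesis
    by (rule linear_continuous_on)
qed

lemma closure_image_subset:
  assumes "continuous_on UNIV f" "f ` S \<subseteq> S" "x \<in> closure S"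
  shows "f x \<in> closure S"
proof -
  have "f ` closure S \<subseteq> closure S"
  proof (rule image_closure_subset)
    show "continuous_on (closure S) f"
      using assms(1) by (rule continuous_on_subset) simp
    show "f ` S \<subseteq> closure S"
      using assms(2) closure_subset by (rule order_trans)
  qed simp
  then show ?thesis
    using assms(3) by blast
qed

lemma csubspace_closure:
  assumes "csubspace (S :: 'a::cstar_algebra set)"
  shows "csubspace (closure S)"
proof (rule complex_vector.subspaceI)
  show "0 \<in> closure S"
    using assms complex_vector.subspace_0 closure_subset by blast
  show "x + y \<in> closure S" if "x \<in> closure S" "y \<in> closure S" for x y
    using that assms unfolding closure_sequential
    by (metis (mono_tags, lifting) complex_vector.subspace_add tendsto_add)
  show "c *\<^sub>C x \<in> closure S" if "x \<in> closure S" for c x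
    using that assms
    by (intro closure_image_subset[OF continuous_on_scaleC])
      (auto intro: complex_vector.subspace_scale)
qed

text \<open>Used with a span as \<open>S\<close> to show the span invariant under multiplication,
  and with \<open>S = {0}\<close> to show that annihilated elements form a subspace.\<close>

lemma csubspace_vimage_mult:
  assumes "csubspace (S :: 'a::cstar_algebra set)"
  shows "csubspace {w. a * w \<in> S}" "csubspace {w. w * a \<in> S}"
  using assms
  by (auto intro!: complex_vector.subspaceI
      simp: distrib_left distrib_right mult_scaleC_left mult_scaleC_right
        complex_vector.subspace_0 complex_vector.subspace_add complex_vector.subspace_scale)

lemma closed_two_sided_ideal_closure_cspan:
  fixes G :: "'a::cstar_algebra set"
  assumes "\<And>a g. g \<in> G \<Longrightarrow> a * g \<in> G \<and> g * a \<in> G"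
  shows "closed_two_sided_ideal (closure (cspan G))"
  unfolding closed_two_sided_ideal_def
proof (intro conjI allI ballI)
  show "csubspace (closure (cspan G))"
    by (intro csubspace_closure complex_vector.subspace_span)
  \<comment> \<open>Each preimage is a subspace containing \<open>G\<close>, so it contains the
    span; continuity of multiplication then carries invariance over to the closure.\<close>
  have "cspan G \<subseteq> {w. a * w \<in> cspan G}" "cspan G \<subseteq> {w. w * a \<in> cspan G}" for a
    using assms by (intro complex_vector.span_minimal csubspace_vimage_mult
        complex_vector.subspace_span; auto intro: complex_vector.span_base)+
  then have invariant: "(\<lambda>w. a * w) ` cspan G \<subseteq> cspan G" "(\<lambda>w. w * a) ` cspan G \<subseteq> cspan G" for a
    by blast+
  fix a w
  assume w: "w \<in> closure (cspan G)"
  show "a * w \<in> closure (cspan G)"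
    using continuous_on_mult_left[OF continuous_on_id] invariant(1) w
    by (rule closure_image_subset)
  show "w * a \<in> closure (cspan G)"
    using continuous_on_mult_right[OF continuous_on_id] invariant(2) w
    by (rule closure_image_subset)
qed simp

lemma closed_two_sided_ideal_commutator_ideal:
  "closed_two_sided_ideal (commutator_ideal :: 'a::cstar_algebra set)"
  unfolding commutator_ideal_def
proof (rule closed_two_sided_ideal_closure_cspan)
  fix a g :: 'a
  assume "g \<in> {u * commutator x y * v |u v x y. True}"
  then obtain u v x y where "g = u * commutator x y * v"
    by blast
  then have "a * g = (a * u) * commutator x y * v" "g * a = u * commutator x y * (v * a)"
    by (simp_all add: mult.assoc)
  then show "a * g \<in> {u * commutator x y * v |u v x y. True} \<and>
      g * a \<in> {u * commutator x y * v |u v x y. True}"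
    by blast
qed

text \<open>The elements killed by a fixed \<open>z\<close> on both sides form a closed subspace, so
  killing the generators is enough.\<close>

lemma annihilator_closure_cspan:
  "annihilator (closure (cspan G)) = annihilator (G :: 'a::cstar_algebra set)"
proof
  have "G \<subseteq> closure (cspan G)"
    using complex_vector.span_superset closure_subset by (rule order_trans)
  then show "annihilator (closure (cspan G)) \<subseteq> annihilator G"
    by (auto simp: annihilator_def)
  show "annihilator G \<subseteq> annihilator (closure (cspan G))"
  proof
    fix z assume z: "z \<in> annihilator G"
    have "csubspace ({w. z * w \<in> {0}} \<inter> {w. w * z \<in> {0}})"
      by (intro complex_vector.subspace_inter csubspace_vimage_mult
          complex_vector.subspace_single_0)
    then have "cspan G \<subseteq> {w. z * w = 0} \<inter> {w. w * z = 0}"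
      using z by (intro complex_vector.span_minimal) (auto simp: annihilator_def)
    moreover have "closed ({w. z * w = 0} \<inter> {w. w * z = 0})"
      by (intro closed_Int closed_Collect_eq continuous_intros)
    ultimately show "z \<in> annihilator (closure (cspan G))"
      using closure_minimal[of "cspan G" "{w. z * w = 0} \<inter> {w. w * z = 0}"]
      by (auto simp: annihilator_def)
  qed
qed

lemma star_kills_commutators_imp_center_annihilator:
  fixes a :: "'a::cstar_algebra"
  assumes a: "\<And>x y. star a * commutator x y = 0"
  shows "a \<in> center \<inter> annihilator commutator_ideal"
proof -
  have left: "star a * (u * commutator x y) = 0" for u x y
  proof -
    have "star a * (u * commutator x y)
        = star a * commutator (u * x) y - (star a * commutator u y) * x"
      by (simp only: commutator_leibniz[of u] right_diff_distrib mult.assoc)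
    then show ?thesis
      by (simp add: a)
  qed
  have comm_zero: "commutator a x = 0" for x
  proof -
    \<comment> \<open>Here \<open>star [a, x] = [star x, star a]\<close> is expanded. The first term
      vanishes by the assumption, the second by \<open>left\<close> with
      \<open>u = star x\<close>.\<close>
    have "star (commutator a x) * commutator a x
        = star x * (star a * commutator a x) - star a * (star x * commutator a x)"
      by (simp add: star_commutator commutator_def[of "star x"] left_diff_distrib mult.assoc)
    also have "\<dots> = 0"
      by (simp only: a left mult_zero_right diff_self)
    finally show ?thesis
      by (simp add: star_mult_self_eq_0_iff)
  qed
  then have comm: "a * x = x * a" for x
    by (simp add: commutator_def)
  \<comment> \<open>Apply \<open>star\<close> to the assumption for the pair \<open>star y\<close>,
    \<open>star x\<close>: the order of the factors reverses and the commutator becomes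
    \<open>[x, y]\<close>.\<close>
  have right: "commutator x y * a = 0" for x y
    using arg_cong[OF a[of "star y" "star x"], of star]
    by (simp add: star_mult star_commutator star_star)
  have "u * commutator x y * v * a = 0" for u v x y
  proof -
    \<comment> \<open>Centrality moves \<open>a\<close> past \<open>v\<close>, next to the
      commutator; it also yields multiplication by \<open>a\<close> from the other side.\<close>
    have "u * commutator x y * v * a = u * (commutator x y * a) * v"
      by (simp only: mult.assoc comm[of v])
    then show ?thesis
      by (simp add: right)
  qed
  then have "a \<in> annihilator {u * commutator x y * v |u v x y. True}"
    by (auto simp: annihilator_def comm)
  then show ?thesis
    by (simp add: center_def comm commutator_ideal_def annihilator_closure_cspan)
qed

text \<open>Take \<open>u = v = 1\<close>; this is where the unit enters.\<close>

lemma commutator_in_commutator_ideal: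
  "commutator x y \<in> (commutator_ideal :: 'a::unital_cstar_algebra set)"
proof -
  have "commutator x y \<in> {u * commutator x y * v |u v x y. True}"
    by (rule CollectI, intro exI[of _ 1] exI[of _ x] exI[of _ y]) simp
  then show ?thesis
    unfolding commutator_ideal_def
    by (intro subsetD[OF closure_subset] complex_vector.span_base)
qed

theorem theorem6p4:
  fixes T Tadj :: "'a::unital_cstar_algebra \<Rightarrow> 'a"
  assumes "bounded_conj_linear T"
    and "is_conj_adjoint T Tadj"
  shows "range T \<subseteq> center
    \<and> closed_two_sided_ideal (commutator_ideal :: 'a set)
    \<and> (\<exists>a \<in> center \<inter> annihilator commutator_ideal. \<forall>x. T x = star x * a)
    \<and> Tadj = T
    \<and> ((\<exists>x y :: 'a. x * y \<noteq> y * x) \<and> (center :: 'a set) = range (\<lambda>c. c *\<^sub>C 1)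
        \<longrightarrow> T = (\<lambda>x. 0))"
proof -
  define a where "a = T 1"
  have adj: "star (T x) * y = star (Tadj y) * x" for x y
    using assms(2) by (simp add: is_conj_adjoint_def module_inner_def star_mult star_star)
  have Tadj: "Tadj y = star y * a" for y
    using arg_cong[OF adj[of 1 y], of star] by (simp add: star_mult star_star a_def)
  \<comment> \<open>With \<open>y = 1\<close> the factor \<open>Tadj 1\<close> appears, which equals
    \<open>a\<close> by the formula for \<open>Tadj\<close>.\<close>
  have T: "T x = star x * a" for x
    using arg_cong[OF adj[of x 1], of star] by (simp add: star_mult star_star Tadj)
  \<comment> \<open>Under both formulas \<open>adj\<close> reads
    \<open>star a * x * y = star a * y * x\<close>.\<close>
  have "star a * commutator x y = 0" for x y
    using adj[of x y]
    by (simp add: T Tadj star_mult star_star commutator_def right_diff_distrib mult.assoc)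
  then have a: "a \<in> center \<inter> annihilator commutator_ideal"
    by (rule star_kills_commutators_imp_center_annihilator)
  then have comm: "a * x = x * a" and kill: "commutator x y * a = 0" for x y
    using commutator_in_commutator_ideal by (auto simp: center_def annihilator_def)
  \<comment> \<open>As \<open>a\<close> is central, the difference of the two sides is
    \<open>[star x, y] * a\<close>, which is zero.\<close>
  have "T x * y = y * T x" for x y
    using kill[of "star x" y] comm[of y]
    by (simp add: T commutator_def left_diff_distrib mult.assoc)
  then have "range T \<subseteq> center"
    by (auto simp: center_def)
  moreover have "T = (\<lambda>x. 0)"
    if "x * y \<noteq> y * x" and center: "center = range (\<lambda>c. c *\<^sub>C (1::'a))" for x y :: 'a
  proof -
    obtain c where c: "a = c *\<^sub>C 1"
      using a center by auto
    \<comment> \<open>A scalar \<open>a\<close> kills the nonzero commutator \<open>[x, y]\<close>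
      only if the scalar is zero.\<close>
    have "c *\<^sub>C commutator x y = 0"
      using kill[of x y] by (simp add: c mult_scaleC_right)
    then have "c = 0"
      using that(1) by (simp add: commutator_def)
    then show ?thesis
      by (simp add: T c fun_eq_iff)
  qed
  moreover have "Tadj = T"
    by (simp add: T Tadj fun_eq_iff)
  ultimately show ?thesis
    using closed_two_sided_ideal_commutator_ideal a T by blast
qed

end
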